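(* Let $S$ be a nontrivial finite semigroup and put $\mathbf{V}_n=(\beta\alpha)^n\llbracket S\rrbracket$ for $n\geq0$. Then the hierarchy $\mathbf{V}_0\subseteq\mathbf{V}_1\subseteq\mathbf{V}_2\subseteq\cdots$ is strict, i.e. $\mathbf{V}_n\subsetneq\mathbf{V}_{n+1}$ for all $n\geq0$.
   Context: All semigroups are finite; a pseudovariety is a class of finite semigroups closed under finite direct products, subsemigroups and homomorphic images, and $\llbracket\mathscr{K}\rrbracket$ is the pseudovariety generated by a class $\mathscr{K}$. For a semigroup $S$, $S^\bullet=S$ if $S$ is a monoid and $S^\bullet=S^I$ (external identity adjoined) otherwise; $S^{\mathsf{bar}}$ is the semigroup of transformations of $S^\bullet$ (acting on the right) consisting of right multiplications by elements of $S$ together with all constant maps on $S^\bullet$. $S^{\mathsf{op}}$ is $S$ with reversed multiplication and $S^\flat=((S^{\mathsf{op}})^{\mathsf{bar}})^{\mathsf{op}}$. For a pseudovariety $\mathbf{V}$, $\alpha\mathbf{V}=\llbracket S^{\mathsf{bar}}\mid S\in\mathbf{V}\rrbracket$ and $\beta\mathbf{V}=\llbracket S^\flat\mid S\in\mathbf{V}\rrbracket$. *)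

theory Defs
  imports Main "HOL-Library.Nat_Bijection" "HOL-Library.FuncSet"
begin

text \<open>A (finite) semigroup is represented by its carrier set together with a
binary operation (only its values on the carrier matter).\<close>
type_synonym 'a sgrp = "'a set \<times> ('a \<Rightarrow> 'a \<Rightarrow> 'a)"

definition carr :: "'a sgrp \<Rightarrow> 'a set" where "carr S = fst S"
definition mul :: "'a sgrp \<Rightarrow> 'a \<Rightarrow> 'a \<Rightarrow> 'a" where "mul S = snd S"

definition fin_sgrp :: "'a sgrp \<Rightarrow> bool" where
  "fin_sgrp S \<longleftrightarrow> carr S \<noteq> {} \<and> finite (carr S)
     \<and> (\<forall>x\<in>carr S. \<forall>y\<in>carr S. mul S x y \<in> carr S)
     \<and> (\<forall>x\<in>carr S. \<forall>y\<in>carr S. \<forall>z\<in>carr S. mul S (mul S x y) z = mul S x (mul S y z))"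

definition sgrp_hom :: "'a sgrp \<Rightarrow> 'b sgrp \<Rightarrow> ('a \<Rightarrow> 'b) \<Rightarrow> bool" where
  "sgrp_hom S T h \<longleftrightarrow> h ` carr S \<subseteq> carr T
     \<and> (\<forall>x\<in>carr S. \<forall>y\<in>carr S. h (mul S x y) = mul T (h x) (h y))"

definition sgrp_iso :: "'a sgrp \<Rightarrow> 'b sgrp \<Rightarrow> bool" where
  "sgrp_iso S T \<longleftrightarrow> (\<exists>h. sgrp_hom S T h \<and> bij_betw h (carr S) (carr T))"

text \<open>Every finite semigroup is isomorphic to one with carrier in nat, so classes of
finite semigroups (pseudovarieties) are represented as sets of nat-carried semigroups.\<close>

definition prod_sgrp :: "nat sgrp \<Rightarrow> nat sgrp \<Rightarrow> nat sgrp" where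
  "prod_sgrp S T = (prod_encode ` (carr S \<times> carr T),
     \<lambda>u v. case prod_decode u of (a, b) \<Rightarrow> case prod_decode v of (c, d) \<Rightarrow>
        prod_encode (mul S a c, mul T b d))"

definition pseudovariety :: "nat sgrp set \<Rightarrow> bool" where
  "pseudovariety P \<longleftrightarrow>
     (\<forall>S\<in>P. fin_sgrp S)
   \<and> (\<forall>S\<in>P. \<forall>T\<in>P. prod_sgrp S T \<in> P)
   \<and> (\<forall>S\<in>P. \<forall>B. B \<noteq> {} \<and> B \<subseteq> carr S \<and> (\<forall>x\<in>B. \<forall>y\<in>B. mul S x y \<in> B)
        \<longrightarrow> (B, mul S) \<in> P)
   \<and> (\<forall>S\<in>P. \<forall>T h. fin_sgrp T \<and> sgrp_hom S T h \<and> h ` carr S = carr T \<longrightarrow> T \<in> P)"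

definition gen_pv :: "nat sgrp set \<Rightarrow> nat sgrp set" where
  "gen_pv K = \<Inter>{P. pseudovariety P \<and> K \<subseteq> P}"

definition gen_pv1 :: "'a sgrp \<Rightarrow> nat sgrp set" where
  "gen_pv1 S = gen_pv {T. fin_sgrp T \<and> sgrp_iso T S}"

definition is_monoid :: "'a sgrp \<Rightarrow> bool" where
  "is_monoid S \<longleftrightarrow> (\<exists>e\<in>carr S. \<forall>x\<in>carr S. mul S e x = x \<and> mul S x e = x)"

definition lift_mul :: "('a \<Rightarrow> 'a \<Rightarrow> 'a) \<Rightarrow> 'a option \<Rightarrow> 'a option \<Rightarrow> 'a option" where
  "lift_mul f x y = (case x of None \<Rightarrow> y
      | Some a \<Rightarrow> (case y of None \<Rightarrow> x | Some b \<Rightarrow> Some (f a b)))"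

definition bullet :: "'a sgrp \<Rightarrow> 'a option sgrp" where
  "bullet S = (Some ` carr S \<union> (if is_monoid S then {} else {None}), lift_mul (mul S))"

text \<open>S^bar: right multiplications by elements of S together with all constant maps
on S^bullet; transformations act on the right, so (u v)(x) = v (u x).  Maps are
restricted to the carrier of S^bullet.\<close>
definition bar :: "'a sgrp \<Rightarrow> ('a option \<Rightarrow> 'a option) sgrp" where
  "bar S = (let C = carr (bullet S) in
     ((\<lambda>s. restrict (\<lambda>x. mul (bullet S) x (Some s)) C) ` carr S
       \<union> (\<lambda>c. restrict (\<lambda>_. c) C) ` C,
      \<lambda>u v. restrict (\<lambda>x. v (u x)) C))"

definition opp :: "'a sgrp \<Rightarrow> 'a sgrp" where
  "opp S = (carr S, \<lambda>x y. mul S y x)"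

definition flat :: "'a sgrp \<Rightarrow> ('a option \<Rightarrow> 'a option) sgrp" where
  "flat S = opp (bar (opp S))"

definition alpha :: "nat sgrp set \<Rightarrow> nat sgrp set" where
  "alpha V = gen_pv {T. fin_sgrp T \<and> (\<exists>S\<in>V. sgrp_iso T (bar S))}"

definition beta :: "nat sgrp set \<Rightarrow> nat sgrp set" where
  "beta V = gen_pv {T. fin_sgrp T \<and> (\<exists>S\<in>V. sgrp_iso T (flat S))}"

end

theory Submission
  imports Defs
begin

text \<open>Each member of the hierarchy satisfies an identity that fails in every nontrivial class
  \<open>V\<close> closed under \<open>bar\<close> and \<open>flat\<close>, whereas equality of two consecutive members would
  produce such a class.

  If \<open>z\<close> does not occur in \<open>u\<close> and \<open>v\<close>, then \<open>bar T \<Turnstile> p z u = q z v\<close> implies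
  \<open>T \<Turnstile> u = v\<close>, and dually for \<open>flat\<close>. An identity in which fresh letters are
  wrapped alternately to the left and to the right of two distinct letters therefore fails in \<open>V\<close>.
  Given a finite semigroup \<open>S\<close>, the remaining letters can be chosen such that the two
  sides agree under every assignment identifying two letters, and with more than \<open>|S|\<close> letters
  this covers all assignments in \<open>S\<close>. Such an identity is passed up the hierarchy because
  \<open>T \<Turnstile> u = v\<close> implies \<open>bar T \<Turnstile> u t = v t\<close> when \<open>t\<close> contains all letters
  of \<open>u\<close> and \<open>v\<close>, and dually for \<open>flat\<close>.\<close>

section \<open>Words and identities\<close>

text \<open>Words are evaluated in \<open>S\<close> with a new identity \<open>None\<close> adjoined, so that the empty
  word needs no special treatment.\<close>

primrec ev :: "'a sgrp \<Rightarrow> (nat \<Rightarrow> 'a) \<Rightarrow> nat list \<Rightarrow> 'a option" where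
  "ev S f [] = None"
| "ev S f (l # w) = lift_mul (mul S) (Some (f l)) (ev S f w)"

definition sat :: "'a sgrp \<Rightarrow> nat list \<Rightarrow> nat list \<Rightarrow> bool" where
  "sat S u v \<longleftrightarrow> (\<forall>f. range f \<subseteq> carr S \<longrightarrow> ev S f u = ev S f v)"

lemma lift_mul_simps [simp]:
  "lift_mul m None y = y" "lift_mul m x None = x" "lift_mul m (Some a) (Some b) = Some (m a b)"
  by (auto simp: lift_mul_def split: option.splits)

lemma mul_closed: "fin_sgrp S \<Longrightarrow> x \<in> carr S \<Longrightarrow> y \<in> carr S \<Longrightarrow> mul S x y \<in> carr S"
  by (simp add: fin_sgrp_def)

lemma mul_assoc:
  "fin_sgrp S \<Longrightarrow> x \<in> carr S \<Longrightarrow> y \<in> carr S \<Longrightarrow> z \<in> carr S \<Longrightarrow>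
    mul S (mul S x y) z = mul S x (mul S y z)"
  by (simp add: fin_sgrp_def)

lemma lift_mul_closed:
  assumes "fin_sgrp S" "x \<in> insert None (Some ` carr S)" "y \<in> insert None (Some ` carr S)"
  shows "lift_mul (mul S) x y \<in> insert None (Some ` carr S)"
  using assms by (auto simp: mul_closed)

lemma lift_mul_assoc:
  assumes "fin_sgrp S" "x \<in> insert None (Some ` carr S)" "y \<in> insert None (Some ` carr S)"
    "z \<in> insert None (Some ` carr S)"
  shows "lift_mul (mul S) (lift_mul (mul S) x y) z = lift_mul (mul S) x (lift_mul (mul S) y z)"
  using assms by (auto simp: mul_assoc)

lemma ev_closed:
  assumes "fin_sgrp S" "range f \<subseteq> carr S"
  shows "ev S f w \<in> insert None (Some ` carr S)"
proof (induction w)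
  case (Cons l w)
  have "Some (f l) \<in> insert None (Some ` carr S)" using assms(2) by auto
  then show ?case unfolding ev.simps by (rule lift_mul_closed[OF assms(1) _ Cons.IH])
qed simp

lemma ev_append:
  assumes "fin_sgrp S" "range f \<subseteq> carr S"
  shows "ev S f (u @ v) = lift_mul (mul S) (ev S f u) (ev S f v)"
proof (induction u)
  case (Cons l u)
  have "Some (f l) \<in> insert None (Some ` carr S)" using assms(2) by auto
  then show ?case
    using Cons lift_mul_assoc[OF assms(1) _ ev_closed[OF assms, of u] ev_closed[OF assms, of v]]
    by simp
qed simp

lemma ev_eq_None [simp]: "ev S f w = None \<longleftrightarrow> w = []"
  by (cases w) (auto simp: lift_mul_def split: option.splits)

lemma ev_cong: "(\<And>l. l \<in> set w \<Longrightarrow> f l = g l) \<Longrightarrow> ev S f w = ev S g w"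
  by (induction w) auto

section \<open>Opposite semigroups and reversal of words\<close>

lemma carr_opp [simp]: "carr (opp S) = carr S"
  and mul_opp [simp]: "mul (opp S) = (\<lambda>x y. mul S y x)"
  by (auto simp: opp_def carr_def mul_def)

lemma opp_opp [simp]: "opp (opp S) = S"
  by (auto simp: opp_def carr_def mul_def)

lemma fin_sgrp_opp [simp]: "fin_sgrp (opp S) \<longleftrightarrow> fin_sgrp S"
  by (auto simp: fin_sgrp_def)

lemma ev_opp:
  assumes "fin_sgrp S" "range f \<subseteq> carr S"
  shows "ev (opp S) f w = ev S f (rev w)"
proof (induction w)
  case (Cons l w)
  then show ?case
    by (auto simp: ev_append[OF assms] lift_mul_def split: option.splits)
qed simp

lemma sat_opp: "fin_sgrp S \<Longrightarrow> sat (opp S) u v \<longleftrightarrow> sat S (rev u) (rev v)"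
  unfolding sat_def by (auto simp: ev_opp)

section \<open>Identities under homomorphisms\<close>

lemma ev_hom:
  assumes "fin_sgrp S" "sgrp_hom S T h" "range f \<subseteq> carr S"
  shows "ev T (h \<circ> f) w = map_option h (ev S f w)"
proof (induction w)
  case (Cons l w)
  have "f l \<in> carr S" using assms(3) by auto
  then show ?case
    using Cons ev_closed[OF assms(1,3), of w] assms(2)
    by (auto simp: sgrp_hom_def)
qed simp

text \<open>Every assignment in \<open>T\<close> is the image under \<open>h\<close> of one in
  \<open>S\<close>, chosen through a right inverse of \<open>h\<close>.\<close>

lemma sat_surj:
  assumes S: "fin_sgrp S" and h: "sgrp_hom S T h" "h ` carr S = carr T" and sat: "sat S u v"
  shows "sat T u v"
  unfolding sat_def
proof (intro allI impI)
  fix f :: "nat \<Rightarrow> _" assume f: "range f \<subseteq> carr T"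
  define g where "g = inv_into (carr S) h \<circ> f"
  have g: "range g \<subseteq> carr S" "h \<circ> g = f"
    using f h(2) by (auto simp: g_def fun_eq_iff image_subset_iff f_inv_into_f inv_into_into)
  show "ev T f u = ev T f v"
    using ev_hom[OF S h(1) g(1)] sat g unfolding sat_def by metis
qed

text \<open>Two homomorphisms that jointly separate points reflect identities. This form serves
  direct products, subsemigroups and isomorphic copies alike.\<close>

lemma sat_subdirect:
  assumes P: "fin_sgrp P" and h: "sgrp_hom P S h" "sgrp_hom P T k"
    and inj: "inj_on (\<lambda>x. (h x, k x)) (carr P)" and sat: "sat S u v" "sat T u v"
  shows "sat P u v"
  unfolding sat_def
proof (intro allI impI)
  fix f :: "nat \<Rightarrow> _" assume f: "range f \<subseteq> carr P"
  have "range (h \<circ> f) \<subseteq> carr S" "range (k \<circ> f) \<subseteq> carr T"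
    using f h by (auto simp: sgrp_hom_def image_subset_iff)
  then have eq: "map_option h (ev P f u) = map_option h (ev P f v)"
    "map_option k (ev P f u) = map_option k (ev P f v)"
    using sat by (simp_all add: sat_def ev_hom[OF P h(1) f, symmetric] ev_hom[OF P h(2) f, symmetric])
  show "ev P f u = ev P f v"
  proof (cases "ev P f u")
    case None
    then show ?thesis using eq(1) by simp
  next
    case (Some a)
    then obtain b where b: "ev P f v = Some b" using eq(1) by (cases "ev P f v") auto
    have "a \<in> carr P" "b \<in> carr P"
      using ev_closed[OF P f, of u] ev_closed[OF P f, of v] Some b by auto
    then show ?thesis using eq Some b inj_onD[OF inj] by auto
  qed
qed

lemma sat_iso:
  assumes "fin_sgrp S" "sgrp_iso S T"
  shows "sat S u v \<longleftrightarrow> sat T u v"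
proof -
  obtain h where h: "sgrp_hom S T h" "inj_on h (carr S)" "h ` carr S = carr T"
    using assms(2) by (auto simp: sgrp_iso_def bij_betw_def)
  then have "inj_on (\<lambda>x. (h x, h x)) (carr S)" by (auto simp: inj_on_def)
  then show ?thesis
    using sat_surj[OF assms(1) h(1,3)] sat_subdirect[OF assms(1) h(1) h(1)] by blast
qed

section \<open>Pseudovarieties\<close>

lemma carr_pair [simp]: "carr (A, m) = A" and mul_pair [simp]: "mul (A, m) = m"
  by (simp_all add: carr_def mul_def)

lemma carr_prod: "carr (prod_sgrp S T) = prod_encode ` (carr S \<times> carr T)"
  and mul_prod: "mul (prod_sgrp S T) (prod_encode (a, b)) (prod_encode (c, d)) =
    prod_encode (mul S a c, mul T b d)"
  by (simp_all add: prod_sgrp_def)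

lemma fin_sgrp_prod:
  assumes "fin_sgrp S" "fin_sgrp T" shows "fin_sgrp (prod_sgrp S T)"
  using assms unfolding fin_sgrp_def carr_prod by (auto simp: mul_prod)

lemma fin_sgrp_sub:
  assumes "fin_sgrp S" "B \<noteq> {}" "B \<subseteq> carr S" "\<forall>x\<in>B. \<forall>y\<in>B. mul S x y \<in> B"
  shows "fin_sgrp (B, mul S)"
  using assms unfolding fin_sgrp_def by (simp add: finite_subset subset_iff)

lemma pseudovariety_prod:
  "pseudovariety P \<Longrightarrow> S \<in> P \<Longrightarrow> T \<in> P \<Longrightarrow> prod_sgrp S T \<in> P"
  by (simp add: pseudovariety_def)

lemma pseudovariety_sub:
  "pseudovariety P \<Longrightarrow> S \<in> P \<Longrightarrow> B \<noteq> {} \<and> B \<subseteq> carr S \<and> (\<forall>x\<in>B. \<forall>y\<in>B. mul S x y \<in> B) \<Longrightarrow>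
    (B, mul S) \<in> P"
  by (simp add: pseudovariety_def)

lemma pseudovariety_quotient:
  assumes "pseudovariety P" "S \<in> P" and T: "fin_sgrp T \<and> sgrp_hom S T h \<and> h ` carr S = carr T"
  shows "T \<in> P"
proof -
  have "\<forall>S\<in>P. \<forall>T h. fin_sgrp T \<and> sgrp_hom S T h \<and> h ` carr S = carr T \<longrightarrow> T \<in> P"
    using assms(1) unfolding pseudovariety_def by (elim conjE)
  from bspec[OF this assms(2)] show ?thesis using T by iprover
qed

lemma pseudovariety_all: "pseudovariety {S. fin_sgrp S}"
  unfolding pseudovariety_def mem_Collect_eq
  by (intro conjI ballI allI impI; simp add: fin_sgrp_prod fin_sgrp_sub)

text \<open>The easy half of the Birkhoff correspondence; by it an identity has to be checked only
  on the generators of a pseudovariety.\<close>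

lemma pseudovariety_sat: "pseudovariety {S. fin_sgrp S \<and> sat S u v}"
proof -
  have "sat (prod_sgrp S T) u v"
    if "fin_sgrp S" "fin_sgrp T" "sat S u v" "sat T u v" for S T
  proof (rule sat_subdirect[OF fin_sgrp_prod[OF that(1,2)] _ _ _ that(3,4)])
    show "sgrp_hom (prod_sgrp S T) S (fst \<circ> prod_decode)"
      "sgrp_hom (prod_sgrp S T) T (snd \<circ> prod_decode)"
      unfolding sgrp_hom_def carr_prod by (auto simp: mul_prod)
    show "inj_on (\<lambda>x. ((fst \<circ> prod_decode) x, (snd \<circ> prod_decode) x)) (carr (prod_sgrp S T))"
      by (auto simp: inj_on_def carr_prod)
  qed
  moreover have "sat (B, mul S) u v"
    if "fin_sgrp S" "B \<noteq> {}" "B \<subseteq> carr S" "\<forall>x\<in>B. \<forall>y\<in>B. mul S x y \<in> B" "sat S u v" for S :: "nat sgrp" and B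
    by (rule sat_subdirect[of _ S id S id])
      (use that fin_sgrp_sub[of S B] in \<open>auto simp: sgrp_hom_def inj_on_def\<close>)
  ultimately show ?thesis
    unfolding pseudovariety_def mem_Collect_eq
    by (intro conjI ballI allI impI; simp add: fin_sgrp_prod fin_sgrp_sub; metis sat_surj)
qed

lemma gen_pv_superset: "K \<subseteq> gen_pv K"
  by (auto simp: gen_pv_def)

lemma gen_pv_least: "pseudovariety P \<Longrightarrow> K \<subseteq> P \<Longrightarrow> gen_pv K \<subseteq> P"
  by (auto simp: gen_pv_def)

lemma pseudovariety_gen_pv:
  assumes "\<forall>S\<in>K. fin_sgrp S" shows "pseudovariety (gen_pv K)"
proof -
  \<comment> \<open>The class of all finite semigroups is one of the classes being intersected, so
    no infinite semigroup survives.\<close>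
  have "gen_pv K \<subseteq> {S. fin_sgrp S}"
    by (rule gen_pv_least[OF pseudovariety_all]) (use assms in auto)
  then have fin: "\<forall>S\<in>gen_pv K. fin_sgrp S" by blast
  have mem: "S \<in> gen_pv K \<longleftrightarrow> (\<forall>P. pseudovariety P \<and> K \<subseteq> P \<longrightarrow> S \<in> P)" for S
    by (simp add: gen_pv_def)
  show ?thesis
    unfolding pseudovariety_def[of "gen_pv K"]
  proof (intro conjI fin ballI allI impI)
    fix S T assume "S \<in> gen_pv K" "T \<in> gen_pv K"
    then show "prod_sgrp S T \<in> gen_pv K" by (simp add: mem pseudovariety_prod)
  next
    fix S B
    assume "S \<in> gen_pv K" and B: "B \<noteq> {} \<and> B \<subseteq> carr S \<and> (\<forall>x\<in>B. \<forall>y\<in>B. mul S x y \<in> B)"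
    then show "(B, mul S) \<in> gen_pv K" using pseudovariety_sub[OF _ _ B] by (simp add: mem)
  next
    fix S T :: "nat sgrp" and h
    assume "S \<in> gen_pv K" and T: "fin_sgrp T \<and> sgrp_hom S T h \<and> h ` carr S = carr T"
    then show "T \<in> gen_pv K" using pseudovariety_quotient[OF _ _ T] by (simp only: mem) blast
  qed
qed

lemma sat_gen_pv:
  assumes "\<forall>S\<in>K. fin_sgrp S \<and> sat S u v" shows "\<forall>S\<in>gen_pv K. sat S u v"
  using gen_pv_least[OF pseudovariety_sat, of K u v] assms by auto

lemma pseudovariety_fin: "pseudovariety P \<Longrightarrow> S \<in> P \<Longrightarrow> fin_sgrp S"
  by (simp add: pseudovariety_def)

text \<open>The image of \<open>h\<close> is a subsemigroup of \<open>B\<close>, and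
  \<open>T\<close> is a homomorphic image of it under the inverse of \<open>h\<close>.\<close>

lemma pseudovariety_embed:
  assumes P: "pseudovariety P" "B \<in> P" and T: "fin_sgrp T"
    and h: "sgrp_hom T B h" "inj_on h (carr T)"
  shows "T \<in> P"
proof -
  let ?A = "h ` carr T"
  have "mul B (h a) (h b) \<in> ?A" if "a \<in> carr T" "b \<in> carr T" for a b
    using h(1) that mul_closed[OF T that] unfolding sgrp_hom_def by (metis imageI)
  then have "?A \<noteq> {} \<and> ?A \<subseteq> carr B \<and> (\<forall>x\<in>?A. \<forall>y\<in>?A. mul B x y \<in> ?A)"
    using T h(1) by (auto simp: fin_sgrp_def sgrp_hom_def)
  then have A: "(?A, mul B) \<in> P" by (rule pseudovariety_sub[OF P])
  have k: "inv_into (carr T) h (h x) = x" if "x \<in> carr T" for x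
    using h(2) that by simp
  have "sgrp_hom (?A, mul B) T (inv_into (carr T) h)"
    unfolding sgrp_hom_def
  proof (intro conjI ballI)
    fix x y assume "x \<in> carr (?A, mul B)" "y \<in> carr (?A, mul B)"
    then obtain a b where ab: "a \<in> carr T" "b \<in> carr T" "x = h a" "y = h b" by auto
    then have "mul B x y = h (mul T a b)" "mul T a b \<in> carr T"
      using h(1) mul_closed[OF T] by (auto simp: sgrp_hom_def)
    then show "inv_into (carr T) h (mul (?A, mul B) x y) =
      mul T (inv_into (carr T) h x) (inv_into (carr T) h y)"
      using ab k by simp
  qed (use k in auto)
  moreover have "inv_into (carr T) h ` ?A = carr T"
    using k by force
  ultimately show ?thesis
    using pseudovariety_quotient[OF P(1) A] T by simp
qed

lemma sgrp_iso_sym: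
  assumes "sgrp_iso S T" "fin_sgrp S" shows "sgrp_iso T S"
proof -
  obtain h where h: "sgrp_hom S T h" "bij_betw h (carr S) (carr T)"
    using assms(1) by (auto simp: sgrp_iso_def)
  let ?k = "inv_into (carr S) h"
  have k: "bij_betw ?k (carr T) (carr S)" by (rule bij_betw_inv_into[OF h(2)])
  have "?k (mul T x y) = mul S (?k x) (?k y)" if "x \<in> carr T" "y \<in> carr T" for x y
  proof -
    have kx: "?k x \<in> carr S" "?k y \<in> carr S" using k that by (auto simp: bij_betw_def)
    then have "mul T x y = h (mul S (?k x) (?k y))"
      using h that by (simp add: sgrp_hom_def bij_betw_inv_into_right)
    then show ?thesis
      using bij_betw_inv_into_left[OF h(2)] mul_closed[OF assms(2) kx] by simp
  qed
  then show ?thesis using k unfolding sgrp_iso_def sgrp_hom_def bij_betw_def by blast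
qed

text \<open>Classes contain semigroups on natural numbers only, whereas \<open>bar\<close> and
  \<open>flat\<close> produce semigroups of maps; these enter a class through such copies.\<close>

lemma nat_copy:
  assumes "fin_sgrp (S :: 'a sgrp)"
  obtains T :: "nat sgrp" where "fin_sgrp T" "sgrp_iso T S"
proof -
  obtain g :: "'a \<Rightarrow> nat" where g: "inj_on g (carr S)"
    using assms finite_imp_inj_to_nat_seg[of "carr S"] by (auto simp: fin_sgrp_def)
  let ?k = "inv_into (carr S) g"
  let ?T = "(g ` carr S, \<lambda>x y. g (mul S (?k x) (?k y)))"
  have k: "?k (g x) = x" if "x \<in> carr S" for x using g that by simp
  have "fin_sgrp ?T"
    using assms unfolding fin_sgrp_def by (auto simp: k)
  moreover have "sgrp_iso S ?T"
    unfolding sgrp_iso_def sgrp_hom_def using g k by (auto simp: bij_betw_def)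
  ultimately show ?thesis using that sgrp_iso_sym assms by blast
qed

section \<open>Identities of the bar and flat semigroups\<close>

lemma mul_bullet [simp]: "mul (bullet S) = lift_mul (mul S)"
  by (simp add: bullet_def)

lemma carr_bullet: "carr (bullet S) = Some ` carr S \<union> (if is_monoid S then {} else {None})"
  by (simp add: bullet_def)

lemma carr_bullet_subset: "carr (bullet S) \<subseteq> insert None (Some ` carr S)"
  by (auto simp: carr_bullet)

lemma Some_in_bullet [simp]: "Some a \<in> carr (bullet S) \<longleftrightarrow> a \<in> carr S"
  by (auto simp: carr_bullet)

lemma bullet_act_closed:
  "fin_sgrp S \<Longrightarrow> x \<in> carr (bullet S) \<Longrightarrow> s \<in> carr S \<Longrightarrow>
    lift_mul (mul S) x (Some s) \<in> carr (bullet S)"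
  by (cases x) (auto simp: mul_closed)

text \<open>Covers both forms of \<open>bullet S\<close>, with an inner or an adjoined identity. At
  the point \<open>e\<close> a right multiplication reveals its factor.\<close>

lemma bullet_unit:
  obtains e where "e \<in> carr (bullet S)" "\<And>s. s \<in> carr S \<Longrightarrow> lift_mul (mul S) e (Some s) = Some s"
proof (cases "is_monoid S")
  case True
  then obtain e where "e \<in> carr S" "\<forall>x\<in>carr S. mul S e x = x" by (auto simp: is_monoid_def)
  then show ?thesis by (intro that[of "Some e"]) auto
next
  case False
  then show ?thesis by (intro that[of None]) (auto simp: carr_bullet)
qed

section \<open>Elements of the bar semigroup and their products\<close>

definition rmult :: "'a sgrp \<Rightarrow> 'a \<Rightarrow> 'a option \<Rightarrow> 'a option" where
  "rmult S s = restrict (\<lambda>x. lift_mul (mul S) x (Some s)) (carr (bullet S))"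

definition rconst :: "'a sgrp \<Rightarrow> 'a option \<Rightarrow> 'a option \<Rightarrow> 'a option" where
  "rconst S c = restrict (\<lambda>_. c) (carr (bullet S))"

lemma carr_bar: "carr (bar S) = rmult S ` carr S \<union> rconst S ` carr (bullet S)"
  and mul_bar: "mul (bar S) = (\<lambda>u v. restrict (\<lambda>x. v (u x)) (carr (bullet S)))"
  by (auto simp: bar_def Let_def rmult_def rconst_def)

lemma rmult_apply [simp]: "x \<in> carr (bullet S) \<Longrightarrow> rmult S s x = lift_mul (mul S) x (Some s)"
  by (simp add: rmult_def)

lemma rconst_apply [simp]: "x \<in> carr (bullet S) \<Longrightarrow> rconst S c x = c"
  by (simp add: rconst_def)

lemma bar_maps:
  "fin_sgrp S \<Longrightarrow> g \<in> carr (bar S) \<Longrightarrow> x \<in> carr (bullet S) \<Longrightarrow> g x \<in> carr (bullet S)"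
  by (auto simp: carr_bar bullet_act_closed)

lemma bar_restrict: "g \<in> carr (bar S) \<Longrightarrow> restrict g (carr (bullet S)) = g"
  by (auto simp: carr_bar rmult_def rconst_def)

lemma rmult_mult:
  assumes "fin_sgrp S" "s \<in> carr S" "t \<in> carr S"
  shows "mul (bar S) (rmult S s) (rmult S t) = rmult S (mul S s t)"
proof -
  have "lift_mul (mul S) (lift_mul (mul S) x (Some s)) (Some t) = lift_mul (mul S) x (Some (mul S s t))"
    if "x \<in> carr (bullet S)" for x
    using that assms by (auto simp: carr_bullet mul_assoc split: if_splits)
  then show ?thesis
    using assms by (auto simp: mul_bar rmult_def bullet_act_closed intro!: restrict_ext)
qed

lemma rconst_mult:
  assumes "fin_sgrp S" "g \<in> carr (bar S)" "c \<in> carr (bullet S)"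
  shows "mul (bar S) g (rconst S c) = rconst S c" "mul (bar S) (rconst S c) g = rconst S (g c)"
  using assms by (auto simp: mul_bar rconst_def bar_maps intro!: restrict_ext)

lemma fin_sgrp_bar:
  assumes S: "fin_sgrp S" shows "fin_sgrp (bar S)"
proof -
  have fin: "finite (carr (bullet S))" "carr S \<noteq> {}" "finite (carr S)"
    using S by (auto simp: carr_bullet fin_sgrp_def)
  have "mul (bar S) g h \<in> carr (bar S)" if gh: "g \<in> carr (bar S)" "h \<in> carr (bar S)" for g h
  proof -
    consider s t where "s \<in> carr S" "t \<in> carr S" "g = rmult S s" "h = rmult S t"
      | c where "c \<in> carr (bullet S)" "g = rconst S c"
      | c where "c \<in> carr (bullet S)" "h = rconst S c"
      using gh by (auto simp: carr_bar)
    then show ?thesis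
    proof cases
      case 1
      then show ?thesis using S by (auto simp: rmult_mult carr_bar mul_closed)
    next
      case 2
      then show ?thesis using rconst_mult(2)[OF S gh(2)] bar_maps[OF S gh(2)] by (simp add: carr_bar)
    next
      case 3
      then show ?thesis using rconst_mult(1)[OF S gh(1)] by (simp add: carr_bar)
    qed
  qed
  moreover have "mul (bar S) (mul (bar S) g h) k = mul (bar S) g (mul (bar S) h k)"
    if "g \<in> carr (bar S)" "h \<in> carr (bar S)" "k \<in> carr (bar S)" for g h k
    using that bar_maps[OF S] by (auto simp: mul_bar intro!: restrict_ext)
  moreover have "finite (carr (bar S))" "carr (bar S) \<noteq> {}"
    using fin by (auto simp: carr_bar)
  ultimately show ?thesis by (simp add: fin_sgrp_def)
qed

lemma fin_sgrp_flat: "fin_sgrp S \<Longrightarrow> fin_sgrp (flat S)"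
  by (simp add: flat_def fin_sgrp_bar)

lemma embed_bar:
  assumes S: "fin_sgrp S"
  shows "sgrp_hom S (bar S) (rmult S)" "inj_on (rmult S) (carr S)"
proof -
  show "sgrp_hom S (bar S) (rmult S)"
    using rmult_mult[OF S] by (auto simp: sgrp_hom_def carr_bar)
  obtain e where e: "e \<in> carr (bullet S)"
    "\<And>s. s \<in> carr S \<Longrightarrow> lift_mul (mul S) e (Some s) = Some s" using bullet_unit[of S] by metis
  show "inj_on (rmult S) (carr S)"
  proof (rule inj_onI)
    fix s t assume st: "s \<in> carr S" "t \<in> carr S" "rmult S s = rmult S t"
    have "rmult S s e = rmult S t e" using st(3) by simp
    then show "s = t" using st(1,2) e by simp
  qed
qed

lemma embed_flat:
  assumes "fin_sgrp S"
  shows "sgrp_hom S (flat S) (rmult (opp S))" "inj_on (rmult (opp S)) (carr S)"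
  using embed_bar[of "opp S"] assms by (auto simp: sgrp_hom_def flat_def)

text \<open>Transformations act on the right, so a word moves a point by \<open>fold\<close>, which
  applies the leftmost letter first. The word is nonempty because \<open>ev\<close> sends the empty
  word to \<open>None\<close>.\<close>

lemma ev_bar:
  assumes S: "fin_sgrp S" and F: "range F \<subseteq> carr (bar S)"
  shows "ev (bar S) F (l # w) = Some (restrict (fold F (l # w)) (carr (bullet S)))"
proof (induction w arbitrary: l)
  case Nil
  have "F l \<in> carr (bar S)" using F by auto
  then show ?case by (simp add: bar_restrict)
next
  case (Cons l' w)
  have "F l \<in> carr (bar S)" using F by auto
  then show ?case
    unfolding ev.simps(2)[of _ _ l] Cons
    using bar_maps[OF S] by (auto simp: mul_bar intro!: restrict_ext)
qed

lemma sat_bar_iff: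
  assumes S: "fin_sgrp S" and ne: "u \<noteq> []" "v \<noteq> []"
  shows "sat (bar S) u v \<longleftrightarrow>
    (\<forall>F. range F \<subseteq> carr (bar S) \<longrightarrow> (\<forall>x\<in>carr (bullet S). fold F u x = fold F v x))"
proof -
  have "ev (bar S) F u = ev (bar S) F v \<longleftrightarrow> (\<forall>x\<in>carr (bullet S). fold F u x = fold F v x)"
    if "range F \<subseteq> carr (bar S)" for F
  proof -
    obtain a u' b v' where "u = a # u'" "v = b # v'" using ne by (meson neq_Nil_conv)
    moreover have "restrict g C = restrict h C \<longleftrightarrow> (\<forall>x\<in>C. g x = h x)" for g h and C :: "'b set"
      by (auto simp: restrict_def fun_eq_iff)
    ultimately show ?thesis
      by (simp only: ev_bar[OF S that] option.inject)
  qed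
  then show ?thesis by (simp add: sat_def)
qed

lemma fold_closed:
  assumes "fin_sgrp S" "range F \<subseteq> carr (bar S)" "x \<in> carr (bullet S)"
  shows "fold F w x \<in> carr (bullet S)"
  using assms(3)
proof (induction w arbitrary: x)
  case (Cons l w)
  have "F l \<in> carr (bar S)" using assms(2) by auto
  then show ?case using Cons bar_maps[OF assms(1)] by simp
qed simp

text \<open>The hypothesis on \<open>F\<close> concerns the letters of \<open>w\<close> alone, so
  that constant maps may be assigned to other letters.\<close>

lemma fold_rmult:
  assumes "fin_sgrp S" "range f \<subseteq> carr S" "x \<in> carr (bullet S)"
    "\<And>l. l \<in> set w \<Longrightarrow> F l = rmult S (f l)"
  shows "fold F w x = lift_mul (mul S) x (ev S f w)"
  using assms(3,4)
proof (induction w arbitrary: x)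
  case (Cons l w)
  have fl: "f l \<in> carr S" using assms(2) by auto
  then have "fold F (l # w) x =
      lift_mul (mul S) (lift_mul (mul S) x (Some (f l))) (ev S f w)"
    using Cons bullet_act_closed[OF assms(1)] by simp
  also have "\<dots> = lift_mul (mul S) x (ev S f (l # w))"
    unfolding ev.simps
    using lift_mul_assoc[OF assms(1) _ _ ev_closed[OF assms(1,2), of w], of x "Some (f l)"]
      fl Cons.prems carr_bullet_subset[of S] by blast
  finally show ?case .
qed simp

text \<open>A constant map assigned to a letter of \<open>t\<close> wipes out everything to the left of it.\<close>

lemma sat_bar_lift:
  assumes S: "fin_sgrp S" and sat: "sat S u v" and t: "set u \<subseteq> set t" "set v \<subseteq> set t" "t \<noteq> []"
  shows "sat (bar S) (u @ t) (v @ t)"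
proof -
  have "fold F (u @ t) x = fold F (v @ t) x"
    if F: "range F \<subseteq> carr (bar S)" and x: "x \<in> carr (bullet S)" for F x
  proof (cases "\<exists>l\<in>set t. F l \<in> rconst S ` carr (bullet S)")
    case True
    then obtain l c t1 t2 where l: "t = t1 @ l # t2" "F l = rconst S c"
      by (auto dest: split_list)
    have "fold F t y = fold F t2 c" if "y \<in> carr (bullet S)" for y
      using fold_closed[OF S F that, of t1] l by simp
    then show ?thesis using fold_closed[OF S F x] by simp
  next
    case False
    then have "\<forall>l\<in>set t. \<exists>s\<in>carr S. F l = rmult S s"
      using F unfolding carr_bar by blast
    then obtain g where g: "\<And>l. l \<in> set t \<Longrightarrow> g l \<in> carr S \<and> F l = rmult S (g l)"
      by metis
    \<comment> \<open>A default value for the letters outside \<open>t\<close>, none of which occurs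
      in \<open>u\<close> or \<open>v\<close>.\<close>
    obtain a where a: "a \<in> carr S" using S by (auto simp: fin_sgrp_def)
    define f where "f l = (if l \<in> set t then g l else a)" for l
    have f: "range f \<subseteq> carr S" using g a by (auto simp: f_def)
    have Ff: "F l = rmult S (f l)" if "l \<in> set t" for l
      using g that by (simp add: f_def)
    have "fold F u x = lift_mul (mul S) x (ev S f u)" "fold F v x = lift_mul (mul S) x (ev S f v)"
      by (rule fold_rmult[OF S f x], use Ff t in auto)+
    then have "fold F u x = fold F v x" using sat f by (simp add: sat_def)
    then show ?thesis by simp
  qed
  moreover have "u @ t \<noteq> []" "v @ t \<noteq> []" using t(3) by auto
  ultimately show ?thesis unfolding sat_bar_iff[OF S \<open>u @ t \<noteq> []\<close> \<open>v @ t \<noteq> []\<close>] by blast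
qed

text \<open>Left-right dual of the \<open>bar\<close> case: \<open>flat\<close> is
  \<open>bar\<close> conjugated by \<open>opp\<close>, and \<open>opp\<close> reverses
  words.\<close>

lemma sat_flat_lift:
  assumes "fin_sgrp S" "sat S u v" "set u \<subseteq> set t" "set v \<subseteq> set t" "t \<noteq> []"
  shows "sat (flat S) (t @ u) (t @ v)"
  using sat_bar_lift[of "opp S" "rev u" "rev v" "rev t"] assms
  by (simp add: flat_def sat_opp fin_sgrp_bar)

text \<open>Conversely, assigning to \<open>z\<close> the constant map onto the identity isolates the part of a
  word after the last \<open>z\<close>.\<close>

lemma sat_bar_suffix:
  assumes S: "fin_sgrp S" and sat: "sat (bar S) (p @ z # u) (q @ z # v)"
    and z: "z \<notin> set u" "z \<notin> set v" and ne: "u \<noteq> []" "v \<noteq> []"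
  shows "sat S u v"
  unfolding sat_def
proof (intro allI impI)
  fix f :: "nat \<Rightarrow> _" assume f: "range f \<subseteq> carr S"
  obtain e where e: "e \<in> carr (bullet S)"
    "\<And>s. s \<in> carr S \<Longrightarrow> lift_mul (mul S) e (Some s) = Some s" using bullet_unit[of S] by metis
  define F where "F l = (if l = z then rconst S e else rmult S (f l))" for l
  have F: "range F \<subseteq> carr (bar S)" using e f by (auto simp: F_def carr_bar image_subset_iff)
  have *: "fold F (r @ z # w) e = ev S f w" if "z \<notin> set w" "w \<noteq> []" for r w
  proof -
    have "fold F (r @ z # w) e = fold F w e"
      using fold_closed[OF S F e(1), of r] by (simp add: F_def)
    also have "\<dots> = lift_mul (mul S) e (ev S f w)"
      by (rule fold_rmult[OF S f e(1)]) (use that in \<open>auto simp: F_def\<close>)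
    also have "\<dots> = ev S f w"
      using ev_closed[OF S f, of w] that e(2) by auto
    finally show ?thesis .
  qed
  have "fold F (p @ z # u) e = fold F (q @ z # v) e"
    using sat_bar_iff[OF S, THEN iffD1, OF _ _ sat] F e(1) by blast
  then show "ev S f u = ev S f v" by (simp only: *[OF z(1) ne(1)] *[OF z(2) ne(2)])
qed

lemma sat_flat_prefix:
  assumes "fin_sgrp S" "sat (flat S) (u @ z # p) (v @ z # q)"
    "z \<notin> set u" "z \<notin> set v" "u \<noteq> []" "v \<noteq> []"
  shows "sat S u v"
  using sat_bar_suffix[of "opp S" "rev p" z "rev u" "rev q" "rev v"] assms
  by (simp add: flat_def sat_opp fin_sgrp_bar)

section \<open>The operators alpha and beta\<close>

lemma sat_context:
  assumes "fin_sgrp S" "sat S u v" shows "sat S (p @ u @ q) (p @ v @ q)"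
  using assms by (simp add: sat_def ev_append)

lemma pseudovariety_alpha: "pseudovariety (alpha V)"
  and pseudovariety_beta: "pseudovariety (beta V)"
  unfolding alpha_def beta_def by (rule pseudovariety_gen_pv; simp)+

lemma alpha_copy:
  assumes "fin_sgrp T" "T \<in> V"
  obtains B where "B \<in> alpha V" "fin_sgrp B" "sgrp_iso B (bar T)"
proof -
  obtain B :: "nat sgrp" where B: "fin_sgrp B" "sgrp_iso B (bar T)"
    using nat_copy[OF fin_sgrp_bar[OF assms(1)]] by blast
  then have "B \<in> alpha V"
    unfolding alpha_def using assms(2) by (intro subsetD[OF gen_pv_superset]) blast
  then show ?thesis using that B by blast
qed

lemma beta_copy:
  assumes "fin_sgrp T" "T \<in> V"
  obtains B where "B \<in> beta V" "fin_sgrp B" "sgrp_iso B (flat T)"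
proof -
  obtain B :: "nat sgrp" where B: "fin_sgrp B" "sgrp_iso B (flat T)"
    using nat_copy[OF fin_sgrp_flat[OF assms(1)]] by blast
  then have "B \<in> beta V"
    unfolding beta_def using assms(2) by (intro subsetD[OF gen_pv_superset]) blast
  then show ?thesis using that B by blast
qed

lemma pseudovariety_embed_iso:
  assumes "pseudovariety P" "B \<in> P" "sgrp_iso B C" "fin_sgrp T"
    and h: "sgrp_hom T C h" "inj_on h (carr T)"
  shows "T \<in> P"
proof -
  obtain k where k: "sgrp_hom C B k" "bij_betw k (carr C) (carr B)"
    using sgrp_iso_sym[OF assms(3) pseudovariety_fin[OF assms(1,2)]] unfolding sgrp_iso_def by iprover
  have "inj_on (k \<circ> h) (carr T)"
    using h k(2) by (intro comp_inj_on) (auto simp: bij_betw_def sgrp_hom_def intro: inj_on_subset)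
  moreover have "sgrp_hom T B (k \<circ> h)"
    using h(1) k(1) by (simp add: sgrp_hom_def image_subset_iff)
  ultimately show ?thesis using pseudovariety_embed assms(1,2,4) by iprover
qed

lemma subset_alpha:
  assumes "pseudovariety V" shows "V \<subseteq> alpha V"
proof
  fix T assume T: "T \<in> V"
  have fin: "fin_sgrp T" by (rule pseudovariety_fin[OF assms T])
  obtain B where B: "B \<in> alpha V" "sgrp_iso B (bar T)" using alpha_copy[OF fin T] by metis
  show "T \<in> alpha V"
    by (rule pseudovariety_embed_iso[OF pseudovariety_alpha B fin embed_bar[OF fin]])
qed

lemma subset_beta:
  assumes "pseudovariety V" shows "V \<subseteq> beta V"
proof
  fix T assume T: "T \<in> V"
  have fin: "fin_sgrp T" by (rule pseudovariety_fin[OF assms T])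
  obtain B where B: "B \<in> beta V" "sgrp_iso B (flat T)" using beta_copy[OF fin T] by metis
  show "T \<in> beta V"
    by (rule pseudovariety_embed_iso[OF pseudovariety_beta B fin embed_flat[OF fin]])
qed

lemma sat_alpha:
  assumes "pseudovariety V" "\<forall>T\<in>V. sat T u v" "set u \<subseteq> set t" "set v \<subseteq> set t" "t \<noteq> []"
  shows "\<forall>T\<in>alpha V. sat T (u @ t) (v @ t)"
  unfolding alpha_def
proof (rule sat_gen_pv, intro ballI conjI)
  fix T assume "T \<in> {T. fin_sgrp T \<and> (\<exists>S\<in>V. sgrp_iso T (bar S))}"
  then obtain S where S: "fin_sgrp T" "S \<in> V" "sgrp_iso T (bar S)" by blast
  then show "fin_sgrp T" "sat T (u @ t) (v @ t)"
    using sat_bar_lift[OF pseudovariety_fin[OF assms(1) S(2)] _ assms(3-5)] assms(2)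
    by (simp_all add: sat_iso[OF S(1,3)])
qed

lemma sat_beta:
  assumes "pseudovariety V" "\<forall>T\<in>V. sat T u v" "set u \<subseteq> set t" "set v \<subseteq> set t" "t \<noteq> []"
  shows "\<forall>T\<in>beta V. sat T (t @ u) (t @ v)"
  unfolding beta_def
proof (rule sat_gen_pv, intro ballI conjI)
  fix T assume "T \<in> {T. fin_sgrp T \<and> (\<exists>S\<in>V. sgrp_iso T (flat S))}"
  then obtain S where S: "fin_sgrp T" "S \<in> V" "sgrp_iso T (flat S)" by blast
  then show "fin_sgrp T" "sat T (t @ u) (t @ v)"
    using sat_flat_lift[OF pseudovariety_fin[OF assms(1) S(2)] _ assms(3-5)] assms(2)
    by (simp_all add: sat_iso[OF S(1,3)])
qed

section \<open>Identities failing in every class closed under bar and flat\<close>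

text \<open>Closure is up to isomorphism, as \<open>V\<close> contains semigroups on natural numbers
  only. The last clause excludes trivial classes, where all identities between nonempty words
  hold.\<close>

definition bar_flat_closed :: "nat sgrp set \<Rightarrow> bool" where
  "bar_flat_closed V \<longleftrightarrow>
     (\<forall>T\<in>V. fin_sgrp T \<and> (\<exists>B\<in>V. sgrp_iso B (bar T)) \<and> (\<exists>B\<in>V. sgrp_iso B (flat T)))
     \<and> (\<exists>T\<in>V. card (carr T) \<ge> 2)"

text \<open>Failure is required for every common suffix \<open>q\<close>, because cutting a longer
  identity at a fresh letter leaves the inner words with a common factor still attached on one
  side.\<close>

definition fails_right :: "nat list \<Rightarrow> nat list \<Rightarrow> bool" where
  "fails_right u v \<longleftrightarrow> (\<forall>V q. bar_flat_closed V \<longrightarrow> \<not> (\<forall>T\<in>V. sat T (u @ q) (v @ q)))"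

definition fails_left :: "nat list \<Rightarrow> nat list \<Rightarrow> bool" where
  "fails_left u v \<longleftrightarrow> (\<forall>V p. bar_flat_closed V \<longrightarrow> \<not> (\<forall>T\<in>V. sat T (p @ u) (p @ v)))"

lemma bar_flat_closed_sat:
  assumes V: "bar_flat_closed V" and sat: "\<forall>T\<in>V. sat T u v" and T: "T \<in> V"
  shows "fin_sgrp T" "sat (bar T) u v" "sat (flat T) u v"
proof -
  show "fin_sgrp T" using V T by (simp add: bar_flat_closed_def)
  obtain B C where B: "B \<in> V" "sgrp_iso B (bar T)" and C: "C \<in> V" "sgrp_iso C (flat T)"
    using V T unfolding bar_flat_closed_def by meson
  have "fin_sgrp B" "fin_sgrp C" using V B(1) C(1) by (simp_all add: bar_flat_closed_def)
  then show "sat (bar T) u v" "sat (flat T) u v"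
    using sat B C sat_iso by metis+
qed

text \<open>Passing to \<open>flat T\<close> cuts both sides at the first \<open>z\<close>, so the
  remainders \<open>q\<close> and \<open>r\<close> may differ. What is left carries the common
  prefix \<open>p\<close>, which \<open>fails_left\<close> allows for.\<close>

lemma fails_right_step:
  assumes uv: "fails_left u v" and ne: "u \<noteq> []" "v \<noteq> []"
    and z: "z \<notin> set p" "z \<notin> set u" "z \<notin> set v"
  shows "fails_right (p @ u @ z # q) (p @ v @ z # r)"
  unfolding fails_right_def
proof (intro allI impI notI)
  fix V s assume V: "bar_flat_closed V"
    and sat: "\<forall>T\<in>V. sat T ((p @ u @ z # q) @ s) ((p @ v @ z # r) @ s)"
  have "sat T (p @ u) (p @ v)" if T: "T \<in> V" for T
    by (rule sat_flat_prefix[of T _ z "q @ s" _ "r @ s"])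
      (use bar_flat_closed_sat[OF V sat T] ne z in auto)
  then show False using uv V unfolding fails_left_def by blast
qed

lemma fails_left_step:
  assumes uv: "fails_right u v" and ne: "u \<noteq> []" "v \<noteq> []"
    and z: "z \<notin> set p" "z \<notin> set u" "z \<notin> set v"
  shows "fails_left (q @ z # u @ p) (r @ z # v @ p)"
  unfolding fails_left_def
proof (intro allI impI notI)
  fix V s assume V: "bar_flat_closed V"
    and sat: "\<forall>T\<in>V. sat T (s @ q @ z # u @ p) (s @ r @ z # v @ p)"
  have "sat T (u @ p) (v @ p)" if T: "T \<in> V" for T
    by (rule sat_bar_suffix[of T "s @ q" z _ "s @ r"])
      (use bar_flat_closed_sat[OF V sat T] ne z in auto)
  then show False using uv V unfolding fails_right_def by blast
qed

text \<open>Constant maps multiply as right zeros, so a word takes the value of its last letter, and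
  two distinct constants separate the sides whatever \<open>p\<close> is.\<close>

lemma fails_left_letters: "fails_left [0] [1]"
  unfolding fails_left_def
proof (intro allI impI notI)
  fix V p assume V: "bar_flat_closed V" and sat: "\<forall>T\<in>V. sat T (p @ [0]) (p @ [1])"
  obtain T where T: "T \<in> V" "card (carr T) \<ge> 2" using V unfolding bar_flat_closed_def by blast
  have fin: "fin_sgrp T" and bar: "sat (bar T) (p @ [0]) (p @ [1])"
    using bar_flat_closed_sat[OF V sat T(1)] by simp_all
  then obtain a b where ab: "a \<in> carr T" "b \<in> carr T" "a \<noteq> b"
    using T(2) card_le_Suc0_iff_eq[of "carr T"] by (auto simp: fin_sgrp_def)
  define F where "F l = rconst T (Some (if l = (0::nat) then a else b))" for l
  have F: "range F \<subseteq> carr (bar T)" using ab by (auto simp: F_def carr_bar)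
  have a: "Some a \<in> carr (bullet T)" using ab by simp
  have "fold F (p @ [0]) (Some a) = fold F (p @ [1]) (Some a)"
    using sat_bar_iff[OF fin, THEN iffD1, OF _ _ bar] F a by blast
  then show False
    using fold_closed[OF fin F a, of p] ab(3) by (simp add: F_def)
qed

section \<open>Identities of a finite semigroup\<close>

definition wpow :: "nat list \<Rightarrow> nat \<Rightarrow> nat list" where
  "wpow w n = concat (replicate n w)"

lemma wpow_0 [simp]: "wpow w 0 = []"
  and wpow_Suc: "wpow w (Suc n) = w @ wpow w n"
  and wpow_add: "wpow w (m + n) = wpow w m @ wpow w n"
  by (simp_all add: wpow_def replicate_add)

lemma wpow_Suc2: "wpow w (Suc n) = wpow w n @ w"
  using wpow_add[of w n 1] by (simp add: wpow_def)

lemma set_wpow: "set (wpow w n) \<subseteq> set w"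
  by (auto simp: wpow_def)

lemma ev_context:
  assumes "fin_sgrp S" "range f \<subseteq> carr S" "ev S f u = ev S f v"
  shows "ev S f (p @ u @ q) = ev S f (p @ v @ q)"
  using assms by (simp add: ev_append)

lemma ev_wpow_cong:
  assumes "fin_sgrp S" "range f \<subseteq> carr S" "ev S f u = ev S f v"
  shows "ev S f (wpow u n) = ev S f (wpow v n)"
  by (induction n) (simp_all add: wpow_Suc ev_append[OF assms(1,2)] assms(3))

text \<open>One exponent serves all words and assignments: the factorial of the order of
  \<open>S\<close> is at least the index and a multiple of the period of every element. Writing it
  as \<open>Suc k\<close> lets one factor be split off.\<close>

lemma idempotent_power:
  assumes S: "fin_sgrp S"
  obtains k where "\<And>f w. range f \<subseteq> carr S \<Longrightarrow>
    ev S f (wpow w (Suc k) @ wpow w (Suc k)) = ev S f (wpow w (Suc k))"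
proof -
  define N where "N = card (carr S)"
  define K :: nat where "K = fact N"
  have "ev S f (wpow w (K + K)) = ev S f (wpow w K)" if f: "range f \<subseteq> carr S" for f w
  proof (cases "w = []")
    case True
    then show ?thesis by (simp add: wpow_def)
  next
    case False
    let ?e = "\<lambda>n. ev S f (wpow w n)"
    \<comment> \<open>Exponents start at 1 because the empty power evaluates to \<open>None\<close>;
      \<open>N + 1\<close> powers with at most \<open>N\<close> values then force a
      repetition.\<close>
    have "?e ` {1..N + 1} \<subseteq> Some ` carr S"
    proof
      fix x assume "x \<in> ?e ` {1..N + 1}"
      then obtain n where "x = ?e (Suc n)" by (auto simp: image_iff) (metis Suc_le_D)
      moreover have "?e (Suc n) \<noteq> None" using False by (simp add: wpow_Suc)
      ultimately show "x \<in> Some ` carr S" using ev_closed[OF S f, of "wpow w (Suc n)"] by auto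
    qed
    moreover have "finite (carr S)" using S by (simp add: fin_sgrp_def)
    ultimately have "card (?e ` {1..N + 1}) \<le> N"
      unfolding N_def by (metis card_image card_mono finite_imageI inj_Some inj_on_subset subset_UNIV)
    then have "\<not> inj_on ?e {1..N + 1}" by (intro pigeonhole) simp
    then obtain i j where ij: "i \<in> {1..N + 1}" "j \<in> {1..N + 1}" "?e i = ?e j" "i < j"
      unfolding inj_on_def by (metis nat_neq_iff)
    define d where "d = j - i"
    have step: "?e (i + n) = ?e (i + n + d)" for n
    proof -
      have "?e (i + n) = ?e (j + n)"
        by (simp add: wpow_add ev_append[OF S f] ij(3))
      then show ?thesis using ij(4) by (simp add: d_def add.commute)
    qed
    have shift: "?e (i + n) = ?e (i + n + m * d)" for n m
    proof (induction m)
      case (Suc m)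
      then show ?case using step[of "n + m * d"] by (simp add: algebra_simps)
    qed simp
    have "d dvd K" using ij unfolding K_def d_def by (intro dvd_fact) auto
    then obtain m where m: "K = m * d" by (auto simp: dvd_def mult.commute)
    have "i \<le> K" using ij fact_ge_self[of N] by (simp add: K_def)
    then show ?thesis using shift[of "K - i" m] m by simp
  qed
  moreover obtain k where "K = Suc k" unfolding K_def by (metis fact_nonzero not0_implies_Suc)
  ultimately show ?thesis using that[of k] by (simp flip: wpow_add)
qed

text \<open>Words in the first \<open>i\<close> letters have only finitely many value patterns over
  all assignments. Concatenating representatives of all patterns gives \<open>m\<close>, in which a
  factor can be exchanged for any \<open>r\<close> of the same pattern.\<close>

lemma universal_word:
  assumes S: "fin_sgrp S"
  obtains m where "set m \<subseteq> {..<i}"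
    "\<And>f r. range f \<subseteq> carr S \<Longrightarrow> set r \<subseteq> {..<i} \<Longrightarrow>
      \<exists>p q. set p \<subseteq> {..<i} \<and> set q \<subseteq> {..<i} \<and> ev S f (p @ r @ q) = ev S f m"
proof -
  obtain a where a: "a \<in> carr S" using S by (auto simp: fin_sgrp_def)
  have finS: "finite (carr S)" using S by (simp add: fin_sgrp_def)
  \<comment> \<open>Fixing the value \<open>a\<close> outside the first \<open>i\<close> letters
    leaves finitely many assignments.\<close>
  define F where "F = {f. \<forall>l. (l \<in> {..<i} \<longrightarrow> f l \<in> carr S) \<and> (l \<notin> {..<i} \<longrightarrow> f l = a)}"
  define A where "A = {w. set w \<subseteq> {..<i}}"
  define \<Phi> where "\<Phi> w = restrict (\<lambda>f. ev S f w) F" for w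
  have finF: "finite F" unfolding F_def by (rule finite_set_of_finite_funs) (use finS in auto)
  have FS: "range f \<subseteq> carr S" if "f \<in> F" for f
    using that a unfolding F_def by (auto; metis)
  have "\<Phi> ` A \<subseteq> PiE F (\<lambda>_. insert None (Some ` carr S))"
    unfolding \<Phi>_def using ev_closed[OF S FS] by (intro image_subsetI restrict_PiE_iff[THEN iffD2]) blast
  moreover have "finite (PiE F (\<lambda>_. insert None (Some ` carr S)))"
    using finF finS by (intro finite_PiE) auto
  ultimately have "finite (\<Phi> ` A)" by (rule finite_subset)
  then obtain W where W: "W \<subseteq> A" "finite W" "\<Phi> ` A = \<Phi> ` W"
    using finite_subset_image[of "\<Phi> ` A" \<Phi> A] by blast
  obtain ws where ws: "set ws = W" using finite_list[OF W(2)] by blast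
  define m where "m = concat ws"
  have m: "set m \<subseteq> {..<i}" using ws W(1) by (auto simp: m_def A_def)
  moreover have "\<exists>p q. set p \<subseteq> {..<i} \<and> set q \<subseteq> {..<i} \<and> ev S f (p @ r @ q) = ev S f m"
    if f: "range f \<subseteq> carr S" and r: "set r \<subseteq> {..<i}" for f r
  proof -
    have "\<Phi> r \<in> \<Phi> ` W" using W(3) r by (auto simp: A_def)
    then obtain w where w: "w \<in> W" "\<Phi> r = \<Phi> w" by blast
    define g where "g l = (if l < i then f l else a)" for l
    have g: "g \<in> F" using f a by (auto simp: F_def g_def)
    have "ev S g r = ev S g w" using w(2) g unfolding \<Phi>_def by (metis restrict_apply')
    moreover have "ev S g r = ev S f r" "ev S g w = ev S f w"
      using r w(1) W(1) by (auto intro!: ev_cong simp: g_def A_def subset_iff)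
    ultimately have rw: "ev S f r = ev S f w" by simp
    obtain xs ys where "ws = xs @ w # ys" using w(1) ws by (metis split_list)
    then have eq: "m = concat xs @ w @ concat ys" by (simp add: m_def)
    then have "ev S f (concat xs @ r @ concat ys) = ev S f m"
      using ev_context[OF S f rw] by simp
    then show ?thesis using m eq by (intro exI[of _ "concat xs"] exI[of _ "concat ys"]) auto
  qed
  ultimately show ?thesis using that by blast
qed

text \<open>The value of \<open>M\<close> is an idempotent of the minimal ideal of the subsemigroup generated by the
  first \<open>i\<close> letters, hence the identity of a group containing every \<open>M r M\<close>.\<close>

lemma absorbing_word:
  assumes S: "fin_sgrp S"
  obtains M k where "set M \<subseteq> {..<i}"
    "\<And>f r. range f \<subseteq> carr S \<Longrightarrow> set r \<subseteq> {..<i} \<Longrightarrow> ev S f (wpow (M @ r @ M) (Suc k)) = ev S f M"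
proof -
  obtain k where idem: "\<And>f w. range f \<subseteq> carr S \<Longrightarrow>
      ev S f (wpow w (Suc k) @ wpow w (Suc k)) = ev S f (wpow w (Suc k))"
    using idempotent_power[OF S] by metis
  obtain m where m: "set m \<subseteq> {..<i}" "\<And>f r. range f \<subseteq> carr S \<Longrightarrow> set r \<subseteq> {..<i} \<Longrightarrow>
      \<exists>p q. set p \<subseteq> {..<i} \<and> set q \<subseteq> {..<i} \<and> ev S f (p @ r @ q) = ev S f m"
    using universal_word[OF S, of i] by metis
  define M where "M = wpow m (Suc k)"
  have M: "set M \<subseteq> {..<i}" using set_wpow m(1) unfolding M_def by blast
  moreover have "ev S f (wpow (M @ r @ M) (Suc k)) = ev S f M"
    if f: "range f \<subseteq> carr S" and r: "set r \<subseteq> {..<i}" for f r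
  proof -
    note ctx = ev_context[OF S f]
    have MM: "ev S f (M @ M) = ev S f M" unfolding M_def by (rule idem[OF f])
    define h where "h = wpow (M @ r @ M) (Suc k)"
    have hh: "ev S f (h @ h) = ev S f h" unfolding h_def by (rule idem[OF f])
    have Mh: "ev S f (M @ h) = ev S f h"
      using ctx[OF MM, of "[]" "r @ M @ wpow (M @ r @ M) k"] by (simp add: h_def wpow_Suc)
    have hM: "ev S f (h @ M) = ev S f h"
      using ctx[OF MM, of "wpow (M @ r @ M) k @ M @ r" "[]"] by (simp add: h_def wpow_Suc2)
    have "set h \<subseteq> {..<i}" using set_wpow[of "M @ r @ M" "Suc k"] M r by (auto simp: h_def)
    \<comment> \<open>Universality of \<open>m\<close> puts the value of \<open>M\<close> into the
      ideal generated by that of \<open>h\<close>; the remaining power of \<open>m\<close> is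
      absorbed into \<open>q\<close>.\<close>
    then obtain p q' where "ev S f (p @ h @ q') = ev S f m" using m(2)[OF f] by blast
    from ctx[OF this, of "[]" "wpow m k"]
    obtain q where q: "ev S f (p @ h @ q) = ev S f M" by (auto simp: M_def wpow_Suc)
    \<comment> \<open>The aim is that \<open>M @ wpow y (Suc k)\<close> has the value of
      \<open>M\<close>. As \<open>y\<close> ends in the idempotent \<open>h\<close>, appending
      \<open>h\<close> then changes nothing, while \<open>M @ h\<close> has the value of
      \<open>h\<close>; so \<open>h\<close> and \<open>M\<close> agree.\<close>
    define y where "y = M @ p @ h"
    have yM: "ev S f (y @ M) = ev S f y" using ctx[OF hM, of "M @ p" "[]"] by (simp add: y_def)
    have yh: "ev S f (y @ h) = ev S f y" using ctx[OF hh, of "M @ p" "[]"] by (simp add: y_def)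
    have yq: "ev S f (y @ q) = ev S f M" using ctx[OF q, of M "[]"] MM by (simp add: y_def)
    have ynM: "ev S f (M @ wpow y n @ M) = ev S f (M @ wpow y n)" for n
    proof (cases n)
      case (Suc n')
      then show ?thesis using ctx[OF yM, of "M @ wpow y n'" "[]"] by (simp add: wpow_Suc2)
    qed (simp add: MM)
    have yqn: "ev S f (M @ wpow y n @ wpow q n) = ev S f M" for n
    proof (induction n)
      case (Suc n)
      have "ev S f (M @ wpow y (Suc n) @ wpow q (Suc n)) = ev S f (M @ wpow y n @ M @ wpow q n)"
        using ctx[OF yq, of "M @ wpow y n" "wpow q n"] by (simp add: wpow_Suc[of q] wpow_Suc2[of y])
      also have "\<dots> = ev S f (M @ wpow y n @ wpow q n)"
        using ctx[OF ynM[of n], of "[]" "wpow q n"] by simp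
      finally show ?case using Suc by simp
    qed simp
    \<comment> \<open>\<open>?Q\<close> undoes \<open>?Y\<close> after \<open>M\<close>, and
      \<open>?Y\<close> is idempotent, so inserting \<open>?Y @ ?Q\<close> after
      \<open>M @ ?Y @ M\<close> and merging the two copies of \<open>?Y\<close> removes
      \<open>?Y\<close> altogether.\<close>
    let ?Y = "wpow y (Suc k)" and ?Q = "wpow q (Suc k)"
    have "ev S f (M @ ?Y) = ev S f (M @ ?Y @ M)" by (simp add: ynM)
    also have "\<dots> = ev S f (M @ ?Y @ M @ ?Y @ ?Q)"
      using ctx[OF yqn[of "Suc k"], of "M @ ?Y" "[]"] by simp
    also have "\<dots> = ev S f (M @ ?Y @ ?Y @ ?Q)"
      using ctx[OF ynM[of "Suc k"], of "[]" "?Y @ ?Q"] by simp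
    also have "\<dots> = ev S f (M @ ?Y @ ?Q)"
      using ctx[OF idem[OF f, of y], of M ?Q] by simp
    finally have MY: "ev S f (M @ ?Y) = ev S f M" using yqn by simp
    have "ev S f (M @ h) = ev S f (M @ ?Y @ h)" using ctx[OF MY, of "[]" h] by simp
    also have "\<dots> = ev S f (M @ ?Y)"
      using ctx[OF yh, of "M @ wpow y k" "[]"] by (simp add: wpow_Suc2)
    finally show ?thesis using MY Mh by (simp add: h_def)
  qed
  ultimately show ?thesis using that by blast
qed

text \<open>Under an assignment identifying the new letter \<open>i\<close> with an earlier one, both sides collapse
  to \<open>M\<close>.\<close>

lemma failing_identity_noninj:
  assumes S: "fin_sgrp S" and "i \<ge> 2"
  shows "\<exists>u v. u \<noteq> [] \<and> v \<noteq> [] \<and> set u \<subseteq> {..<i} \<and> set v \<subseteq> {..<i} \<and>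
    (if even i then fails_left u v else fails_right u v) \<and>
    (\<forall>f. range f \<subseteq> carr S \<longrightarrow> \<not> inj_on f {..<i} \<longrightarrow> ev S f u = ev S f v)"
  using assms(2)
proof (induction i rule: dec_induct)
  case base
  have "ev S f [0] = ev S f [1]" if "\<not> inj_on f {..<2}" for f
    using that by (auto simp: inj_on_def less_2_cases_iff)
  then show ?case
    using fails_left_letters by (intro exI[of _ "[0]"] exI[of _ "[1]"]) auto
next
  case (step i)
  then obtain u v where uv: "u \<noteq> []" "v \<noteq> []" "set u \<subseteq> {..<i}" "set v \<subseteq> {..<i}"
    "if even i then fails_left u v else fails_right u v"
    and eq: "\<And>f. range f \<subseteq> carr S \<Longrightarrow> \<not> inj_on f {..<i} \<Longrightarrow> ev S f u = ev S f v" by blast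
  obtain M k where M: "set M \<subseteq> {..<i}" and absorb: "\<And>f r. range f \<subseteq> carr S \<Longrightarrow>
      set r \<subseteq> {..<i} \<Longrightarrow> ev S f (wpow (M @ r @ M) (Suc k)) = ev S f M"
    using absorbing_word[OF S, of i] by metis
  have i: "i \<notin> set u" "i \<notin> set v" "i \<notin> set M" using uv M by auto
  \<comment> \<open>The side on which the fresh letter is attached alternates with the parity of
    \<open>i\<close>, as the two failure properties do.\<close>
  define c where "c l w = (if even i then w @ [l] else l # w)" for l :: nat and w
  define E where "E w = wpow (M @ c i w @ M) (Suc k)" for w
  have ev_c: "ev S f (c l u) = ev S f (c l v)"
    if "range f \<subseteq> carr S" "ev S f u = ev S f v" for f l
    using that by (simp add: c_def ev_append[OF S])
  have E_eq: "ev S f (E u) = ev S f (E v)"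
    if f: "range f \<subseteq> carr S" and ninj: "\<not> inj_on f {..<Suc i}" for f
  proof (cases "inj_on f {..<i}")
    case False
    then show ?thesis
      unfolding E_def using f by (intro ev_wpow_cong[OF S f] ev_context[OF S f] ev_c eq)
  next
    case True
    then obtain j where j: "j < i" "f j = f i"
      using ninj by (auto simp: lessThan_Suc)
    \<comment> \<open>Replacing \<open>i\<close> by \<open>j\<close> brings the word back into the
      first \<open>i\<close> letters, where \<open>absorb\<close> applies.\<close>
    have "ev S f (E w) = ev S f M" if "set w \<subseteq> {..<i}" for w
    proof -
      have "ev S f (c i w) = ev S f (c j w)" using j by (simp add: c_def ev_append[OF S f])
      then have "ev S f (E w) = ev S f (wpow (M @ c j w @ M) (Suc k))"
        unfolding E_def by (intro ev_wpow_cong[OF S f] ev_context[OF S f])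
      also have "\<dots> = ev S f M"
        by (rule absorb[OF f]) (use that j in \<open>auto simp: c_def\<close>)
      finally show ?thesis .
    qed
    then show ?thesis using uv by simp
  qed
  have "if even (Suc i) then fails_left (E u) (E v) else fails_right (E u) (E v)"
  proof (cases "even i")
    case True
    \<comment> \<open>Splitting off the first factor exposes the first \<open>i\<close>, and the
      rest of the power lies beyond the cut. For odd \<open>i\<close> the last factor and the last
      \<open>i\<close> play this role.\<close>
    then have "E w = M @ w @ i # M @ wpow (M @ c i w @ M) k" for w
      by (simp add: E_def wpow_Suc c_def)
    then show ?thesis using True fails_right_step[OF _ uv(1,2) i(3,1,2)] uv(5) by simp
  next
    case False
    then have "E w = (wpow (M @ c i w @ M) k @ M) @ i # w @ M" for w
      by (simp add: E_def wpow_Suc2 c_def)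
    then have "fails_left (E u) (E v)"
      using fails_left_step[OF _ uv(1,2) i(3,1,2)] False uv(5) by (simp only: if_False)
    then show ?thesis using False by simp
  qed
  moreover have "E w \<noteq> []" for w by (simp add: E_def wpow_Suc c_def)
  moreover have "set (E w) \<subseteq> {..<Suc i}" if "set w \<subseteq> {..<i}" for w
  proof -
    have "set (M @ c i w @ M) \<subseteq> {..<Suc i}" using that M by (auto simp: c_def)
    then show ?thesis unfolding E_def by (rule subset_trans[OF set_wpow])
  qed
  ultimately show ?case
    using E_eq uv(3,4) by (intro exI[of _ "E u"] exI[of _ "E v"] conjI allI impI) simp_all
qed

lemma failing_identity:
  assumes S: "fin_sgrp S"
  obtains u v where "u \<noteq> []" "v \<noteq> []" "fails_right u v" "sat S u v"
proof -
  \<comment> \<open>Odd, so that the failure is of the kind \<open>fails_right\<close>, and larger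
    than the order of \<open>S\<close>, so that no assignment is injective on the first
    \<open>i\<close> letters.\<close>
  define i where "i = 2 * card (carr S) + 3"
  have "\<not> inj_on f {..<i}" if "range f \<subseteq> carr S" for f
  proof
    assume "inj_on f {..<i}"
    then have "card {..<i} \<le> card (carr S)"
      using that S by (intro card_inj_on_le) (auto simp: fin_sgrp_def)
    then show False by (simp add: i_def)
  qed
  moreover have "i \<ge> 2" "odd i" by (simp_all add: i_def)
  ultimately show ?thesis
    using failing_identity_noninj[OF S, of i] that unfolding sat_def by auto
qed

text \<open>Each operator requires a common word containing all letters on one side. A fresh letter
  placed on the other side, by multiplying both sides with it, preserves the identity and makes the
  opposite failure property available.\<close>

lemma failing_identity_lift:
  assumes V: "pseudovariety V" and uv: "u \<noteq> []" "v \<noteq> []" "fails_right u v" "\<forall>T\<in>V. sat T u v"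
  obtains u' v' where "u' \<noteq> []" "v' \<noteq> []" "fails_right u' v'" "\<forall>T\<in>beta (alpha V). sat T u' v'"
proof -
  obtain z where z: "z \<notin> set (u @ v)" using ex_new_if_finite[OF infinite_UNIV_nat] by blast
  define a b where "a = z # u @ (u @ v)" and "b = z # v @ (u @ v)"
  have sat0: "\<forall>T\<in>alpha V. sat T (u @ u @ v) (v @ u @ v)"
    by (rule sat_alpha[OF V uv(4)]) (use uv in auto)
  have sat1: "\<forall>T\<in>alpha V. sat T a b"
  proof
    fix T assume "T \<in> alpha V"
    then show "sat T a b"
      using sat_context[of T "u @ u @ v" "v @ u @ v" "[z]" "[]"] sat0
        pseudovariety_fin[OF pseudovariety_alpha] by (simp add: a_def b_def)
  qed
  have ab: "fails_left a b"
    using fails_left_step[OF uv(3,1,2), of z "u @ v" "[]" "[]"] z by (simp add: a_def b_def)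
  obtain z' where z': "z' \<notin> set (a @ b)" using ex_new_if_finite[OF infinite_UNIV_nat] by blast
  define c d where "c = (a @ b) @ a @ [z']" and "d = (a @ b) @ b @ [z']"
  have sat2: "\<forall>T\<in>beta (alpha V). sat T ((a @ b) @ a) ((a @ b) @ b)"
    by (rule sat_beta[OF pseudovariety_alpha sat1]) (auto simp: a_def)
  have "\<forall>T\<in>beta (alpha V). sat T c d"
  proof
    fix T assume "T \<in> beta (alpha V)"
    then show "sat T c d"
      using sat_context[of T "(a @ b) @ a" "(a @ b) @ b" "[]" "[z']"] sat2
        pseudovariety_fin[OF pseudovariety_beta] by (simp add: c_def d_def)
  qed
  moreover have "fails_right c d"
    unfolding c_def d_def
    by (rule fails_right_step[OF ab]) (use z' in \<open>auto simp: a_def b_def\<close>)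
  moreover have "c \<noteq> []" "d \<noteq> []" by (simp_all add: c_def d_def)
  ultimately show ?thesis using that by blast
qed

theorem theorem4p9:
  fixes S :: "'a sgrp"
  assumes "fin_sgrp S" and "card (carr S) \<ge> 2"
  shows "\<forall>n::nat. ((beta \<circ> alpha) ^^ n) (gen_pv1 S) \<subset> ((beta \<circ> alpha) ^^ Suc n) (gen_pv1 S)"
proof
  fix n
  define W where "W n = ((beta \<circ> alpha) ^^ n) (gen_pv1 S)" for n
  have W0: "W 0 = gen_pv1 S" and WSuc: "W (Suc n) = beta (alpha (W n))" for n
    by (simp_all add: W_def)
  have pv: "pseudovariety (W n)" for n
  proof (cases n)
    case 0
    then show ?thesis by (simp add: W0 gen_pv1_def pseudovariety_gen_pv)
  qed (simp add: WSuc pseudovariety_beta)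
  have sub: "W n \<subseteq> alpha (W n)" "alpha (W n) \<subseteq> W (Suc n)" for n
    using subset_alpha[OF pv] subset_beta[OF pseudovariety_alpha] by (simp_all add: WSuc)
  \<comment> \<open>A copy of \<open>S\<close> that stays in all members of the hierarchy and
    witnesses their nontriviality.\<close>
  obtain T :: "nat sgrp" where T: "fin_sgrp T" "sgrp_iso T S" using nat_copy[OF assms(1)] by blast
  have TW: "T \<in> W n" for n
  proof (induction n)
    case 0
    show ?case
      unfolding W0 gen_pv1_def by (rule subsetD[OF gen_pv_superset]) (use T in simp)
  next
    case (Suc n)
    show ?case by (rule subsetD[OF sub(2) subsetD[OF sub(1) Suc]])
  qed
  have cardT: "card (carr T) \<ge> 2"
    using T(2) assms(2) by (auto simp: sgrp_iso_def dest: bij_betw_same_card)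
  have ident: "\<exists>u v. u \<noteq> [] \<and> v \<noteq> [] \<and> fails_right u v \<and> (\<forall>T\<in>W n. sat T u v)" for n
  proof (induction n)
    case 0
    obtain u v where uv: "u \<noteq> []" "v \<noteq> []" "fails_right u v" "sat S u v"
      using failing_identity[OF assms(1)] by blast
    have "\<forall>T\<in>W 0. sat T u v"
      unfolding W0 gen_pv1_def
    proof (rule sat_gen_pv, intro ballI conjI)
      fix U assume "U \<in> {T. fin_sgrp T \<and> sgrp_iso T S}"
      then have U: "fin_sgrp U" "sgrp_iso U S" by simp_all
      then show "fin_sgrp U" "sat U u v" using uv(4) by (simp_all add: sat_iso[OF U])
    qed
    then show ?case using uv by blast
  next
    case (Suc n)
    then obtain u v where uv: "u \<noteq> []" "v \<noteq> []" "fails_right u v" "\<forall>T\<in>W n. sat T u v" by blast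
    show ?case by (rule failing_identity_lift[OF pv uv]) (unfold WSuc, iprover)
  qed
  have "W n \<noteq> W (Suc n)"
  proof
    assume eq: "W n = W (Suc n)"
    \<comment> \<open>Equality squeezes \<open>alpha (W n)\<close> between two equal classes, so
      \<open>W n\<close> absorbs \<open>bar\<close> as well as \<open>flat\<close>.\<close>
    have "bar_flat_closed (W n)"
      unfolding bar_flat_closed_def
    proof (intro conjI ballI)
      show "\<exists>T\<in>W n. card (carr T) \<ge> 2" using TW cardT by blast
    next
      fix U assume U: "U \<in> W n"
      show fin: "fin_sgrp U" by (rule pseudovariety_fin[OF pv U])
      obtain B where "B \<in> alpha (W n)" "sgrp_iso B (bar U)" by (rule alpha_copy[OF fin U])
      then have "B \<in> W n" "sgrp_iso B (bar U)" using sub(2)[of n] eq by auto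
      then show "\<exists>B\<in>W n. sgrp_iso B (bar U)" by (intro bexI)
      obtain C where "C \<in> W (Suc n)" "sgrp_iso C (flat U)"
        unfolding WSuc by (rule beta_copy[OF fin subsetD[OF sub(1) U]])
      then show "\<exists>B\<in>W n. sgrp_iso B (flat U)" unfolding eq by (intro bexI)
    qed
    moreover obtain u v where "fails_right u v" "\<forall>T\<in>W n. sat T u v" using ident[of n] by blast
    ultimately have "\<not> (\<forall>T\<in>W n. sat T (u @ []) (v @ []))" unfolding fails_right_def by blast
    then show False using \<open>\<forall>T\<in>W n. sat T u v\<close> unfolding append_Nil2 by (rule notE)
  qed
  moreover have "W n \<subseteq> W (Suc n)" using sub by blast
  ultimately show "((beta \<circ> alpha) ^^ n) (gen_pv1 S) \<subset> ((beta \<circ> alpha) ^^ Suc n) (gen_pv1 S)"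
    unfolding W_def by blast
qed

end
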